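(* A locally finite digraph $D$ can be generated by some (possibly infinite) set of derangements if and only if, for every finite $T\subseteq V(D)$, the following three conditions hold: (i) $|N^+_D(T)|\ge|T|$ and $|N^-_D(T)|\ge|T|$; (ii) if $|N^+_D(T)|=|T|$, then $N^-_D(N^+_D(T))=T$; (iii) if $|N^-_D(T)|=|T|$, then $N^+_D(N^-_D(T))=T$.
   Context: A digraph $D=(V,E)$ has a (possibly infinite) vertex set $V$ and arc set $E\subseteq\{(x,y):x,y\in V,\ x\ne y\}$. For $x\in V$, $N^+_D(x)=\{y:(x,y)\in E\}$ and $N^-_D(x)=\{y:(y,x)\in E\}$; for $S\subseteq V$, $N^\pm_D(S)=\bigcup_{x\in S}N^\pm_D(x)$. $D$ is locally finite if $|N^+_D(x)|$ and $|N^-_D(x)|$ are finite for all $x$. A derangement of $V$ is a fixed-point-free bijection $V\to V$; a set $\mathcal{S}$ of derangements generates $D$ if $E=\{(x,x^\sigma):x\in V,\ \sigma\in\mathcal{S}\}$.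
   Formalization: The generating set of derangements is required to be nonempty; otherwise the empty set generates every arcless digraph, and an arcless digraph with a vertex violates condition (i). *)

theory Defs
  imports "Graph_Theory.Pair_Digraph"
begin

definition out_nbrs :: "'a pair_pre_digraph \<Rightarrow> 'a \<Rightarrow> 'a set" where
  "out_nbrs D x = {y. (x, y) \<in> parcs D}"

definition in_nbrs :: "'a pair_pre_digraph \<Rightarrow> 'a \<Rightarrow> 'a set" where
  "in_nbrs D x = {y. (y, x) \<in> parcs D}"

definition Out_nbrs :: "'a pair_pre_digraph \<Rightarrow> 'a set \<Rightarrow> 'a set" where
  "Out_nbrs D S = (\<Union>x\<in>S. out_nbrs D x)"

definition In_nbrs :: "'a pair_pre_digraph \<Rightarrow> 'a set \<Rightarrow> 'a set" where
  "In_nbrs D S = (\<Union>x\<in>S. in_nbrs D x)"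

definition locally_finite_digraph :: "'a pair_pre_digraph \<Rightarrow> bool" where
  "locally_finite_digraph D \<longleftrightarrow>
     (\<forall>x\<in>pverts D. finite (out_nbrs D x) \<and> finite (in_nbrs D x))"

text \<open>A bijection of \<open>V\<close> is a function on the whole type whose values outside \<open>V\<close> are irrelevant.\<close>

definition derangement_on :: "'a set \<Rightarrow> ('a \<Rightarrow> 'a) \<Rightarrow> bool" where
  "derangement_on V \<sigma> \<longleftrightarrow> bij_betw \<sigma> V V \<and> (\<forall>x\<in>V. \<sigma> x \<noteq> x)"

definition generates :: "('a \<Rightarrow> 'a) set \<Rightarrow> 'a pair_pre_digraph \<Rightarrow> bool" where
  "generates \<S> D \<longleftrightarrow>
     (\<forall>\<sigma>\<in>\<S>. derangement_on (pverts D) \<sigma>) \<and>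
     parcs D = {(x, \<sigma> x) | x \<sigma>. x \<in> pverts D \<and> \<sigma> \<in> \<S>}"

text \<open>
  The empty set of derangements generates every arcless digraph, although an arcless digraph with
  a vertex violates \<open>|N\<^sup>+(T)| \<ge> |T|\<close>. The characterisation by Hall-type conditions therefore
  has to ask for a nonempty generating set; this only matters for digraphs without arcs.
\<close>

lemma empty_generates_arcless:
  fixes v :: 'a
  defines "D \<equiv> \<lparr>pverts = {v}, parcs = {}\<rparr>"
  shows "pair_loopfree_digraph D" "locally_finite_digraph D" "generates {} D"
    "\<not> card (Out_nbrs D {v}) \<ge> card {v}"
  unfolding D_def
  by (unfold_locales; simp)
     (simp_all add: locally_finite_digraph_def generates_def Out_nbrs_def out_nbrs_def in_nbrs_def)

lemma generates_nonempty:
  assumes "generates \<S> D" "parcs D \<noteq> {}"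
  shows "\<S> \<noteq> {}"
  using assms by (auto simp: generates_def)

end

theory Submission
  imports Defs
begin

text \<open>
  Necessity is a counting argument. For sufficiency, fix an arc \<open>(a, b)\<close>. The equality clauses (ii)
  and (iii) guarantee that Hall's condition survives, in both directions, when all other arcs leaving \<open>a\<close> or
  entering \<open>b\<close> are deleted. Hall's theorem for locally finite relations then gives one injection of
  \<open>V\<close> into itself along the arcs and one against them, and the Schroeder--Bernstein construction
  merges the two into a bijection along the arcs, which must map \<open>a\<close> to \<open>b\<close>.
\<close>

section \<open>Hall's theorem for relations with finite images\<close>

text \<open>
  Rado's proof: in a minimal relation satisfying Hall's condition every image is a singleton, since
  two points of one image, neither of them deletable, would yield two tight sets contradicting submodularity. Minimal relations
  are obtained from maximal sets \<open>K\<close> of deleted pairs.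
\<close>

lemma Hall_locally_finite:
  fixes R :: "('a \<times> 'b) set"
  assumes fin: "\<And>x. x \<in> I \<Longrightarrow> finite (R `` {x})"
    and hall: "\<And>T. finite T \<Longrightarrow> T \<subseteq> I \<Longrightarrow> card T \<le> card (R `` T)"
  obtains f where "inj_on f I" "\<And>x. x \<in> I \<Longrightarrow> (x, f x) \<in> R"
proof -
  define \<A> where "\<A> = {K. \<forall>T. finite T \<longrightarrow> T \<subseteq> I \<longrightarrow> card T \<le> card ((R - K) `` T)}"
  have finT: "finite (R `` T)" if "finite T" "T \<subseteq> I" for T
  proof -
    have "R `` T = (\<Union>x\<in>T. R `` {x})" by blast
    then show ?thesis using that fin by auto
  qed
  have "\<exists>M\<in>\<A>. \<forall>X\<in>\<A>. M \<subseteq> X \<longrightarrow> X = M"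
  proof (rule subset_Zorn_nonempty)
    have "{} \<in> \<A>" using hall by (simp add: \<A>_def)
    then show "\<A> \<noteq> {}" by blast
  next
    fix \<C> assume ne: "\<C> \<noteq> {}" and ch: "subset.chain \<A> \<C>"
    show "\<Union>\<C> \<in> \<A>"
      unfolding \<A>_def
    proof (intro CollectI allI impI)
      fix T assume T: "finite T" "T \<subseteq> I"
      \<comment> \<open>Only finitely many pairs of \<open>R\<close> start in \<open>T\<close>, so
        those deleted by the union of the chain are already deleted by a single member of
        it.\<close>
      have "R \<inter> T \<times> UNIV \<subseteq> T \<times> R `` T" by blast
      then have "finite (\<Union>\<C> \<inter> (R \<inter> T \<times> UNIV))"
        using finT[OF T] T(1) by (meson finite_Int finite_SigmaI finite_subset)
      then obtain K where K: "K \<in> \<C>" "\<Union>\<C> \<inter> (R \<inter> T \<times> UNIV) \<subseteq> K"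
        using finite_subset_Union_chain[OF _ _ ne ch] by (metis inf_le1)
      have "(R - \<Union>\<C>) `` T = (R - K) `` T" using K by blast
      moreover have "K \<in> \<A>" using K ch by (auto simp: subset.chain_def)
      ultimately show "card T \<le> card ((R - \<Union>\<C>) `` T)" using T by (simp add: \<A>_def)
    qed
  qed
  then obtain M where M: "M \<in> \<A>" and max: "\<And>X. X \<in> \<A> \<Longrightarrow> M \<subseteq> X \<Longrightarrow> X = M" by blast
  define Q where "Q = R - M"
  have QR: "Q \<subseteq> R" by (auto simp: Q_def)
  have hallQ: "card T \<le> card (Q `` T)" if "finite T" "T \<subseteq> I" for T
    using M that by (simp add: \<A>_def Q_def)
  have finQ: "finite (Q `` T)" if "finite T" "T \<subseteq> I" for T
    using finT[OF that] QR by (meson Image_mono finite_subset order_refl)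
  \<comment> \<open>By maximality of \<open>M\<close>, deleting \<open>(x, y)\<close> as well breaks
    Hall's condition at some set. That set must contain \<open>x\<close>; the witness is the set
    without \<open>x\<close>, which turns the strict inequality into \<open>\<le>\<close>.\<close>
  have tight: "\<exists>T. finite T \<and> T \<subseteq> I - {x} \<and> card (Q `` T \<union> (Q `` {x} - {y})) \<le> card T"
    if "x \<in> I" "(x, y) \<in> Q" for x y
  proof -
    have "insert (x, y) M \<notin> \<A>" using max[of "insert (x, y) M"] that by (auto simp: Q_def)
    moreover have "R - insert (x, y) M = Q - {(x, y)}" by (auto simp: Q_def)
    ultimately obtain T where T: "finite T" "T \<subseteq> I" "card ((Q - {(x, y)}) `` T) < card T"
      by (auto simp: \<A>_def not_le)
    have "x \<in> T"
    proof (rule ccontr)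
      assume "x \<notin> T"
      then have "(Q - {(x, y)}) `` T = Q `` T" by blast
      then show False using hallQ[OF T(1,2)] T(3) by simp
    qed
    then have "(Q - {(x, y)}) `` T = Q `` (T - {x}) \<union> (Q `` {x} - {y})" by auto
    moreover have "card T = Suc (card (T - {x}))"
      using \<open>x \<in> T\<close> T(1) card_Suc_Diff1 by metis
    ultimately have "card (Q `` (T - {x}) \<union> (Q `` {x} - {y})) \<le> card (T - {x})"
      using T(3) by simp
    then show ?thesis using T by blast
  qed
  have uniq: "y = z" if x: "x \<in> I" and y: "(x, y) \<in> Q" and z: "(x, z) \<in> Q" for x y z
  proof (rule ccontr)
    assume "y \<noteq> z"
    obtain S where S: "finite S" "S \<subseteq> I - {x}" "card (Q `` S \<union> (Q `` {x} - {y})) \<le> card S"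
      using tight[OF x y] by blast
    obtain T where T: "finite T" "T \<subseteq> I - {x}" "card (Q `` T \<union> (Q `` {x} - {z})) \<le> card T"
      using tight[OF x z] by blast
    let ?A = "Q `` S \<union> (Q `` {x} - {y})" and ?B = "Q `` T \<union> (Q `` {x} - {z})"
    have fin: "finite ?A" "finite ?B" using S T x by (auto intro!: finQ)
    have "?A \<union> ?B = Q `` insert x (S \<union> T)" using \<open>y \<noteq> z\<close> by auto
    moreover have "card (insert x (S \<union> T)) \<le> card (Q `` insert x (S \<union> T))"
      using S T x by (intro hallQ) auto
    moreover have "card (insert x (S \<union> T)) = Suc (card (S \<union> T))"
      using S T by (subst card_insert_disjoint) auto
    ultimately have "Suc (card (S \<union> T)) \<le> card (?A \<union> ?B)" by simp
    moreover have "card (S \<inter> T) \<le> card (?A \<inter> ?B)"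
    proof -
      have "card (S \<inter> T) \<le> card (Q `` (S \<inter> T))" using S T by (intro hallQ) auto
      also have "\<dots> \<le> card (?A \<inter> ?B)" using fin by (intro card_mono) auto
      finally show ?thesis .
    qed
    ultimately show False
      using card_Un_Int[OF fin] card_Un_Int[OF S(1) T(1)] S(3) T(3) by linarith
  qed
  have "\<exists>y. (x, y) \<in> Q" if "x \<in> I" for x
  proof -
    have "card {x} \<le> card (Q `` {x})" using that by (intro hallQ) auto
    then have "Q `` {x} \<noteq> {}" by auto
    then show ?thesis by blast
  qed
  then obtain f where f: "\<And>x. x \<in> I \<Longrightarrow> (x, f x) \<in> Q" by metis
  have "inj_on f I"
  proof (rule inj_onI, rule ccontr)
    fix x y assume xy: "x \<in> I" "y \<in> I" "f x = f y" "x \<noteq> y"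
    have "Q `` {x, y} = {f x}"
    proof
      show "Q `` {x, y} \<subseteq> {f x}" using xy uniq f[OF xy(1)] f[OF xy(2)] by auto
      show "{f x} \<subseteq> Q `` {x, y}" using f[OF xy(1)] by blast
    qed
    moreover have "card {x, y} \<le> card (Q `` {x, y})" using xy by (intro hallQ) auto
    ultimately show False using xy by simp
  qed
  then show thesis using that f QR by blast
qed

section \<open>Merging two opposite injections\<close>

text \<open>The last clause is what the application needs: if \<open>f\<close> follows a relation
  and \<open>g\<close> follows its converse, then \<open>h\<close> follows the relation too.\<close>

lemma Schroeder_Bernstein_graph:
  assumes f: "inj_on f A" "f ` A \<subseteq> B" and g: "inj_on g B" "g ` B \<subseteq> A"
  obtains h where "bij_betw h A B" "\<And>x. x \<in> A \<Longrightarrow> h x = f x \<or> g (h x) = x"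
proof -
  define X where "X = lfp (\<lambda>X. A - g ` (B - f ` X))"
  have "X = A - g ` (B - f ` X)"
    unfolding X_def by (rule lfp_unfold, rule monoI) blast
  then have X: "X \<subseteq> A" "A - X = g ` (B - f ` X)" using g by blast+
  define k where "k = inv_into (B - f ` X) g"
  define h where "h x = (if x \<in> X then f x else k x)" for x
  have "bij_betw g (B - f ` X) (A - X)"
    using g(1) X(2) by (metis Diff_subset bij_betw_imageI inj_on_subset)
  then have "bij_betw k (A - X) (B - f ` X)" unfolding k_def by (rule bij_betw_inv_into)
  then have "bij_betw h (A - X) (B - f ` X)"
    by (rule bij_betw_cong[THEN iffD1, rotated]) (simp add: h_def)
  moreover have "bij_betw h X (f ` X)"
    using f(1) X(1) by (auto simp: bij_betw_def h_def inj_on_def)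
  ultimately have "bij_betw h (X \<union> (A - X)) (f ` X \<union> (B - f ` X))"
    by (intro bij_betw_combine) auto
  moreover have "X \<union> (A - X) = A" "f ` X \<union> (B - f ` X) = B" using X(1) f(2) by blast+
  ultimately have "bij_betw h A B" by simp
  moreover have "h x = f x \<or> g (h x) = x" if "x \<in> A" for x
  proof (cases "x \<in> X")
    case False
    then have "x \<in> g ` (B - f ` X)" using X that by blast
    then show ?thesis using False by (simp add: h_def k_def f_inv_into_f)
  qed (simp add: h_def)
  ultimately show thesis using that by blast
qed

section \<open>Forcing a bijection through a given arc\<close>

text \<open>Any function that follows these pairs and is defined at \<open>a\<close> must send
  \<open>a\<close> to \<open>b\<close>. The form is symmetric under converse, so one argument serves
  both directions.\<close>

definition pin :: "('a \<times> 'b) set \<Rightarrow> 'a \<Rightarrow> 'b \<Rightarrow> ('a \<times> 'b) set" where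
  "pin E a b = insert (a, b) {(x, y) \<in> E. x \<noteq> a \<and> y \<noteq> b}"

lemma converse_pin: "(pin E a b)\<inverse> = pin (E\<inverse>) b a"
  by (auto simp: pin_def)

text \<open>Pinning can cost the image of \<open>T - {a}\<close> only the point \<open>b\<close>. If
  \<open>b\<close> lies in that image, then \<open>a\<close> is a predecessor of the image outside
  \<open>T - {a}\<close>, so the equality clause rules out tightness and there is one point to
  spare. If \<open>a\<close> is in \<open>T\<close>, the pair \<open>(a, b)\<close> brings
  \<open>b\<close> back to account for \<open>a\<close>.\<close>

lemma pin_Hall:
  assumes ab: "(a, b) \<in> E" and T: "finite T" and fin: "finite (E `` T)"
    and le: "card (T - {a}) \<le> card (E `` (T - {a}))"
    and eq: "card (E `` (T - {a})) = card (T - {a}) \<Longrightarrow> E\<inverse> `` (E `` (T - {a})) = T - {a}"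
  shows "card T \<le> card (pin E a b `` T)"
proof -
  let ?T = "T - {a}"
  have fin': "finite (E `` ?T)" using fin by (rule finite_subset[rotated]) blast
  have *: "card ?T \<le> card (E `` ?T - {b})"
  proof (cases "b \<in> E `` ?T")
    case True
    then have "a \<in> E\<inverse> `` (E `` ?T)" using ab by blast
    then have "card (E `` ?T) \<noteq> card ?T" using eq by blast
    then show ?thesis using le True fin' by (simp add: card_Diff_singleton)
  qed (use le in simp)
  show ?thesis
  proof (cases "a \<in> T")
    case True
    have "pin E a b `` T = insert b (E `` ?T - {b})" using True by (auto simp: pin_def)
    moreover have "card (insert b (E `` ?T - {b})) = Suc (card (E `` ?T - {b}))"
      using fin' by (subst card_insert_disjoint) auto
    moreover have "card T = Suc (card ?T)" using True T card_Suc_Diff1 by metis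
    ultimately show ?thesis using * by simp
  next
    case False
    then have "pin E a b `` T = E `` ?T - {b}" by (auto simp: pin_def)
    then show ?thesis using * False by simp
  qed
qed

lemma pin_injection:
  assumes ab: "(a, b) \<in> E"
    and fin: "\<And>x. x \<in> V \<Longrightarrow> finite (E `` {x})"
    and le: "\<And>T. finite T \<Longrightarrow> T \<subseteq> V \<Longrightarrow> card T \<le> card (E `` T)"
    and eq: "\<And>T. finite T \<Longrightarrow> T \<subseteq> V \<Longrightarrow> card (E `` T) = card T \<Longrightarrow> E\<inverse> `` (E `` T) = T"
  obtains f where "inj_on f V" "\<And>x. x \<in> V \<Longrightarrow> (x, f x) \<in> pin E a b"
proof (rule Hall_locally_finite)
  have sub: "pin E a b \<subseteq> E" using ab by (auto simp: pin_def)
  show "finite (pin E a b `` {x})" if "x \<in> V" for x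
    using fin[OF that] by (rule finite_subset[rotated]) (use sub in blast)
  fix T assume T: "finite T" "T \<subseteq> V"
  have "E `` T = (\<Union>x\<in>T. E `` {x})" by blast
  then have "finite (E `` T)" using T fin by auto
  then show "card T \<le> card (pin E a b `` T)"
    using T by (intro pin_Hall[OF ab] le eq) auto
qed (use that in blast)

lemma bijection_through_arc:
  assumes E: "E \<subseteq> V \<times> W" and ab: "(a, b) \<in> E"
    and "\<And>x. x \<in> V \<Longrightarrow> finite (E `` {x})"
    and "\<And>y. y \<in> W \<Longrightarrow> finite (E\<inverse> `` {y})"
    and "\<And>T. finite T \<Longrightarrow> T \<subseteq> V \<Longrightarrow> card T \<le> card (E `` T)"
    and "\<And>T. finite T \<Longrightarrow> T \<subseteq> W \<Longrightarrow> card T \<le> card (E\<inverse> `` T)"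
    and "\<And>T. finite T \<Longrightarrow> T \<subseteq> V \<Longrightarrow> card (E `` T) = card T \<Longrightarrow> E\<inverse> `` (E `` T) = T"
    and "\<And>T. finite T \<Longrightarrow> T \<subseteq> W \<Longrightarrow> card (E\<inverse> `` T) = card T \<Longrightarrow> E `` (E\<inverse> `` T) = T"
  obtains h where "bij_betw h V W" "\<And>x. x \<in> V \<Longrightarrow> (x, h x) \<in> E" "h a = b"
proof -
  obtain f where f: "inj_on f V" "\<And>x. x \<in> V \<Longrightarrow> (x, f x) \<in> pin E a b"
    using pin_injection[OF ab, of V] assms by blast
  have ba: "(b, a) \<in> E\<inverse>" using ab by simp
  obtain g where g: "inj_on g W" "\<And>y. y \<in> W \<Longrightarrow> (y, g y) \<in> pin (E\<inverse>) b a"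
    by (rule pin_injection[OF ba, of W]) (simp_all add: assms)
  have g': "(g y, y) \<in> pin E a b" if "y \<in> W" for y
    using g(2)[OF that] by (simp flip: converse_pin)
  have sub: "pin E a b \<subseteq> E" using ab by (auto simp: pin_def)
  have fW: "f ` V \<subseteq> W" and gV: "g ` W \<subseteq> V" using f g' sub E by blast+
  obtain h where h: "bij_betw h V W" "\<And>x. x \<in> V \<Longrightarrow> h x = f x \<or> g (h x) = x"
    using Schroeder_Bernstein_graph[OF f(1) fW g(1) gV] by blast
  \<comment> \<open>Both alternatives for \<open>h x\<close> give a pinned pair: it is either the
    pair of \<open>f\<close> at \<open>x\<close> or the reversed pair of \<open>g\<close> at
    \<open>h x\<close>.\<close>
  have hpin: "(x, h x) \<in> pin E a b" if "x \<in> V" for x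
    using h(2)[OF that] f(2)[OF that] g'[of "h x"] bij_betwE[OF h(1)] that by metis
  moreover have "h a = b" using hpin[of a] ab E by (auto simp: pin_def)
  ultimately show thesis using that h(1) sub by blast
qed

section \<open>Necessity of the counting conditions\<close>

text \<open>If \<open>|E(T)| = |T|\<close>, then \<open>E(T)\<close> is the image of \<open>T\<close> under every member of \<open>F\<close>.\<close>

lemma Hall_of_injections:
  assumes ne: "F \<noteq> {}" and inj: "\<And>f. f \<in> F \<Longrightarrow> inj_on f V"
    and E: "E = {(x, f x) | x f. x \<in> V \<and> f \<in> F}"
    and T: "T \<subseteq> V" and fin: "finite (E `` T)"
  shows "card T \<le> card (E `` T)"
    and "card (E `` T) = card T \<Longrightarrow> E\<inverse> `` (E `` T) = T"
proof -
  have sub: "f ` T \<subseteq> E `` T" if "f \<in> F" for f using that T E by blast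
  have card: "card (f ` T) = card T" if "f \<in> F" for f
    using inj[OF that] T by (meson card_image inj_on_subset)
  obtain f where "f \<in> F" using ne by blast
  then show "card T \<le> card (E `` T)" using card_mono[OF fin sub] card by metis
  assume eq: "card (E `` T) = card T"
  have img: "f ` T = E `` T" if "f \<in> F" for f
    using card_subset_eq[OF fin sub[OF that]] card[OF that] eq by simp
  show "E\<inverse> `` (E `` T) = T"
  proof
    show "T \<subseteq> E\<inverse> `` (E `` T)" using ne T E by blast
    show "E\<inverse> `` (E `` T) \<subseteq> T"
    proof
      fix z assume "z \<in> E\<inverse> `` (E `` T)"
      then obtain y where y: "(z, y) \<in> E" "y \<in> E `` T" by blast
      from y(1) obtain f where "f \<in> F" "z \<in> V" "y = f z" unfolding E by blast
      with y(2) have f: "f \<in> F" "z \<in> V" "f z \<in> E `` T" by simp_all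
      then show "z \<in> T" using img[OF f(1)] inj_on_image_mem_iff[OF inj[OF f(1)] f(2) T] by simp
    qed
  qed
qed

section \<open>The characterisation\<close>

theorem theorem3p3:
  fixes D :: "'a pair_pre_digraph"
  assumes "pair_loopfree_digraph D"
    and "locally_finite_digraph D"
  shows "(\<exists>\<S>. \<S> \<noteq> {} \<and> generates \<S> D) \<longleftrightarrow>
    (\<forall>T. finite T \<and> T \<subseteq> pverts D \<longrightarrow>
       (card (Out_nbrs D T) \<ge> card T \<and> card (In_nbrs D T) \<ge> card T) \<and>
       (card (Out_nbrs D T) = card T \<longrightarrow> In_nbrs D (Out_nbrs D T) = T) \<and>
       (card (In_nbrs D T) = card T \<longrightarrow> Out_nbrs D (In_nbrs D T) = T))"
proof -
  interpret pair_loopfree_digraph D by fact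
  define V where "V = pverts D"
  define E where "E = parcs D"
  have EV: "E \<subseteq> V \<times> V" by (force simp: E_def V_def dest: arc_fst_in_verts arc_snd_in_verts)
  have loopfree: "x \<noteq> y" if "(x, y) \<in> E" for x y using no_loops' that by (auto simp: E_def)
  have Out: "Out_nbrs D T = E `` T" for T by (auto simp: Out_nbrs_def out_nbrs_def E_def)
  have In: "In_nbrs D T = E\<inverse> `` T" for T by (auto simp: In_nbrs_def in_nbrs_def E_def)
  have fin: "finite (E `` {x})" "finite (E\<inverse> `` {x})" if "x \<in> V" for x
  proof -
    have "E `` {x} = out_nbrs D x" "E\<inverse> `` {x} = in_nbrs D x"
      by (auto simp: out_nbrs_def in_nbrs_def E_def)
    then show "finite (E `` {x})" "finite (E\<inverse> `` {x})"
      using assms(2) that by (simp_all add: locally_finite_digraph_def V_def)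
  qed
  have finT: "finite (E `` T)" "finite (E\<inverse> `` T)" if "finite T" "T \<subseteq> V" for T
  proof -
    have "E `` T = (\<Union>x\<in>T. E `` {x})" "E\<inverse> `` T = (\<Union>x\<in>T. E\<inverse> `` {x})" by blast+
    then show "finite (E `` T)" "finite (E\<inverse> `` T)" using fin that by auto
  qed
  have gen: "generates \<S> D \<longleftrightarrow> (\<forall>\<sigma>\<in>\<S>. derangement_on V \<sigma>) \<and>
      E = {(x, \<sigma> x) | x \<sigma>. x \<in> V \<and> \<sigma> \<in> \<S>}" for \<S>
    by (simp add: generates_def V_def E_def)
  show ?thesis
    unfolding Out In V_def[symmetric]
  proof (intro iffI allI impI)
    fix T
    assume "\<exists>\<S>. \<S> \<noteq> {} \<and> generates \<S> D" and T: "finite T \<and> T \<subseteq> V"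
    then obtain \<S> where ne: "\<S> \<noteq> {}" and der: "\<And>\<sigma>. \<sigma> \<in> \<S> \<Longrightarrow> bij_betw \<sigma> V V"
      and E: "E = {(x, \<sigma> x) | x \<sigma>. x \<in> V \<and> \<sigma> \<in> \<S>}"
      by (auto simp: gen derangement_on_def)
    \<comment> \<open>The inverse derangements generate the reversed arcs, so the in-neighbour
      conditions follow from the same lemma.\<close>
    have E': "E\<inverse> = {(y, f y) | y f. y \<in> V \<and> f \<in> inv_into V ` \<S>}"
    proof -
      have "(y, x) \<in> E\<inverse> \<longleftrightarrow> y \<in> V \<and> (\<exists>\<sigma>\<in>\<S>. x = inv_into V \<sigma> y)" for x y
      proof
        assume "(y, x) \<in> E\<inverse>"
        then obtain \<sigma> where "\<sigma> \<in> \<S>" "x \<in> V" "y = \<sigma> x" using E by blast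
        then show "y \<in> V \<and> (\<exists>\<sigma>\<in>\<S>. x = inv_into V \<sigma> y)"
          using der by (metis bij_betwE bij_betw_inv_into_left)
      next
        assume "y \<in> V \<and> (\<exists>\<sigma>\<in>\<S>. x = inv_into V \<sigma> y)"
        then obtain \<sigma> where \<sigma>: "y \<in> V" "\<sigma> \<in> \<S>" "x = inv_into V \<sigma> y" by blast
        then have "x \<in> V" "\<sigma> x = y"
          using der by (metis bij_betwE bij_betw_inv_into, metis bij_betw_inv_into_right)
        then show "(y, x) \<in> E\<inverse>" using \<sigma>(2) E by blast
      qed
      then show ?thesis by blast
    qed
    have inj: "inj_on \<sigma> V" if "\<sigma> \<in> \<S>" for \<sigma> using der[OF that] by (rule bij_betw_imp_inj_on)
    have inj': "inj_on f V" if "f \<in> inv_into V ` \<S>" for f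
      using that der by (metis bij_betw_imp_inj_on bij_betw_inv_into imageE)
    have ne': "inv_into V ` \<S> \<noteq> {}" using ne by simp
    note out = Hall_of_injections[OF ne inj E, of T]
    note in_ = Hall_of_injections[OF ne' inj' E', of T]
    show "(card T \<le> card (E `` T) \<and> card T \<le> card (E\<inverse> `` T)) \<and>
      (card (E `` T) = card T \<longrightarrow> E\<inverse> `` (E `` T) = T) \<and>
      (card (E\<inverse> `` T) = card T \<longrightarrow> E `` (E\<inverse> `` T) = T)"
      using out in_ finT[of T] T by simp
  next
    assume hyp: "\<forall>T. finite T \<and> T \<subseteq> V \<longrightarrow>
      (card T \<le> card (E `` T) \<and> card T \<le> card (E\<inverse> `` T)) \<and>
      (card (E `` T) = card T \<longrightarrow> E\<inverse> `` (E `` T) = T) \<and>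
      (card (E\<inverse> `` T) = card T \<longrightarrow> E `` (E\<inverse> `` T) = T)"
    \<comment> \<open>The largest candidate: all derangements that follow arcs. It remains to find
      one through each arc.\<close>
    define \<S> where "\<S> = {\<sigma>. derangement_on V \<sigma> \<and> (\<forall>x\<in>V. (x, \<sigma> x) \<in> E)}"
    have through: "\<exists>\<sigma>\<in>\<S>. \<sigma> a = b" if ab: "(a, b) \<in> E" for a b
    proof -
      obtain h where h: "bij_betw h V V" "\<And>x. x \<in> V \<Longrightarrow> (x, h x) \<in> E" "h a = b"
        by (rule bijection_through_arc[OF EV ab]) (use fin hyp in auto)
      have "\<forall>x\<in>V. h x \<noteq> x" using h(2) loopfree by metis
      then have "h \<in> \<S>" using h by (simp add: \<S>_def derangement_on_def)
      then show ?thesis using h(3) by blast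
    qed
    have "E = {(x, \<sigma> x) | x \<sigma>. x \<in> V \<and> \<sigma> \<in> \<S>}"
    proof
      show "E \<subseteq> {(x, \<sigma> x) | x \<sigma>. x \<in> V \<and> \<sigma> \<in> \<S>}" using through EV by fast
      show "{(x, \<sigma> x) | x \<sigma>. x \<in> V \<and> \<sigma> \<in> \<S>} \<subseteq> E" by (auto simp: \<S>_def)
    qed
    then have "generates \<S> D" by (simp add: gen \<S>_def)
    moreover have "\<S> \<noteq> {}"
    proof (cases "V = {}")
      case True
      \<comment> \<open>On the empty vertex set \<open>id\<close> is vacuously a derangement;
        otherwise Hall's condition at a singleton yields an arc, and \<open>through\<close> a member
        of \<open>\<S>\<close>.\<close>
      then have "id \<in> \<S>" by (simp add: \<S>_def derangement_on_def)
      then show ?thesis by blast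
    next
      case False
      then obtain v where "v \<in> V" by blast
      then have "card {v} \<le> card (E `` {v})" using hyp by blast
      then have "E `` {v} \<noteq> {}" by auto
      then show ?thesis using through by blast
    qed
    ultimately show "\<exists>\<S>. \<S> \<noteq> {} \<and> generates \<S> D" by blast
  qed
qed

end
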